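(* Let $G$ and $H$ be graphs and let $f: V(G)\to V(H)$ be a function. Then the Sierpiński product $G\otimes_f H$ is connected if and only if both $G$ and $H$ are connected.
   Context: Graphs are undirected and simple, and have at least one vertex. For graphs $G,H$ and a function $f:V(G)\to V(H)$, the Sierpiński product $G\otimes_f H$ is the graph with vertex set $V(G)\times V(H)$ and the following edges: $\{(g,h),(g,h')\}$ for every $g\in V(G)$ and every $\{h,h'\}\in E(H)$; and $\{(g,f(g')),(g',f(g))\}$ for every $\{g,g'\}\in E(G)$. *)

theory Defs
  imports "Graph_Theory.Graph_Theory"
begin

text \<open>
  An undirected simple graph is represented by a loop-free symmetric digraph without parallel
  arcs: an undirected edge \<open>{u, v}\<close> is the pair of arcs \<open>(u, v)\<close> and \<open>(v, u)\<close>.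
  Graphs are nonempty, and may be infinite. On symmetric digraphs, \<open>connected\<close> of
  \<open>Digraph_Component\<close> is connectedness of the undirected graph.
\<close>

definition simple_graph :: "'a pair_pre_digraph \<Rightarrow> bool" where
  "simple_graph G \<longleftrightarrow> pair_bidirected_digraph G \<and> pverts G \<noteq> {}"

text \<open>Both orientations of each edge belong to the arc set when \<open>G\<close> and \<open>H\<close> are symmetric.\<close>

definition sierpinski_product ::
  "'a pair_pre_digraph \<Rightarrow> ('a \<Rightarrow> 'b) \<Rightarrow> 'b pair_pre_digraph \<Rightarrow> ('a \<times> 'b) pair_pre_digraph"
where
  "sierpinski_product G f H =
    \<lparr> pverts = pverts G \<times> pverts H,
      parcs = {((g, h), (g, h')) | g h h'. g \<in> pverts G \<and> (h, h') \<in> parcs H}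
            \<union> {((g, f g'), (g', f g)) | g g'. (g, g') \<in> parcs G} \<rparr>"

lemma simple_graph_sierpinski_product:
  assumes G: "simple_graph G" and H: "simple_graph H" and f: "f \<in> pverts G \<rightarrow> pverts H"
  shows "simple_graph (sierpinski_product G f H)"
proof -
  interpret G: pair_bidirected_digraph G using G by (simp add: simple_graph_def)
  interpret H: pair_bidirected_digraph H using H by (simp add: simple_graph_def)
  have sG: "(v, u) \<in> parcs G" if "(u, v) \<in> parcs G" for u v
    using G.pair_sym_arcs that by (auto simp: symmetric_def dest: symD)
  have sH: "(v, u) \<in> parcs H" if "(u, v) \<in> parcs H" for u v
    using H.pair_sym_arcs that by (auto simp: symmetric_def dest: symD)
  have lG: "(u, u) \<notin> parcs G" for u using G.pair_no_loops[of "(u, u)"] by auto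
  have lH: "(u, u) \<notin> parcs H" for u using H.pair_no_loops[of "(u, u)"] by auto
  have vG: "u \<in> pverts G \<and> v \<in> pverts G" if "(u, v) \<in> parcs G" for u v
    using G.in_arcsD1[OF that] G.in_arcsD2[OF that] by simp
  have vH: "u \<in> pverts H \<and> v \<in> pverts H" if "(u, v) \<in> parcs H" for u v
    using H.in_arcsD1[OF that] H.in_arcsD2[OF that] by simp
  have "pair_bidirected_digraph (sierpinski_product G f H)"
  proof
    show "symmetric (with_proj (sierpinski_product G f H))"
      unfolding symmetric_def sym_def
      by (auto simp: sierpinski_product_def intro: sG sH)
  qed (use f in \<open>auto simp: sierpinski_product_def lG lH Pi_iff dest: vG vH\<close>)
  then show ?thesis
    using G H by (auto simp: simple_graph_def sierpinski_product_def)
qed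

end

theory Submission
  imports Defs
begin

text \<open>
  If the product is connected, then so is \<open>G\<close>, by projection. For \<open>H\<close>, start a walk at a vertex
  \<open>(g, f g)\<close> and call a vertex \<open>(g', h')\<close> good if \<open>h'\<close> lies in the component of \<open>f g'\<close> in \<open>H\<close>.
  Walking inside a copy of \<open>H\<close> clearly preserves goodness, and a connecting edge merely swaps the
  two vertices that are compared: \<open>(g\<^sub>1, f g\<^sub>2)\<close> and \<open>(g\<^sub>2, f g\<^sub>1)\<close> are good under the same condition.
  Hence every vertex \<open>(g, h)\<close> is good, so all of \<open>H\<close> is the component of \<open>f g\<close>. This also covers
  infinite graphs, where counting edges between components is not available.
\<close>

lemma simple_graph_arc_sym:
  assumes "simple_graph G" "(u, v) \<in> parcs G"
  shows "(v, u) \<in> parcs G"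
proof -
  interpret pair_bidirected_digraph G using assms(1) by (simp add: simple_graph_def)
  show ?thesis using pair_sym_arcs assms(2) by (auto simp: symmetric_def dest: symD)
qed

lemma simple_graph_arc_verts:
  assumes "simple_graph G" "(u, v) \<in> parcs G"
  shows "u \<in> pverts G" "v \<in> pverts G"
proof -
  interpret pair_bidirected_digraph G using assms(1) by (simp add: simple_graph_def)
  show "u \<in> pverts G" "v \<in> pverts G"
    using in_arcsD1[OF assms(2)] in_arcsD2[OF assms(2)] by simp_all
qed

lemma simple_graph_rtrancl_sym:
  assumes "simple_graph G" "(u, v) \<in> (parcs G)\<^sup>*"
  shows "(v, u) \<in> (parcs G)\<^sup>*"
  using assms(2) sym_rtrancl[of "parcs G"] simple_graph_arc_sym[OF assms(1)]
  by (meson symD symI)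

text \<open>\<open>connected\<close> refers to walks in the symmetric closure that stay inside the
  vertex set. Here the arcs are already symmetric and end in vertices, so plain
  \<open>rtrancl\<close> suffices.\<close>

lemma simple_graph_connected_iff:
  assumes "simple_graph G"
  shows "connected (with_proj G) \<longleftrightarrow> (\<forall>u \<in> pverts G. \<forall>v \<in> pverts G. (u, v) \<in> (parcs G)\<^sup>*)"
proof -
  have arcs: "(parcs G)\<^sup>s = parcs G"
    using simple_graph_arc_sym[OF assms] by (auto simp: symcl_def)
  have "(u, v) \<in> rtrancl_on (pverts G) (parcs G) \<longleftrightarrow> (u, v) \<in> (parcs G)\<^sup>*"
    if "u \<in> pverts G" for u v
  proof
    assume "(u, v) \<in> rtrancl_on (pverts G) (parcs G)"
    then show "(u, v) \<in> (parcs G)\<^sup>*" by (rule rtrancl_on_rtranclI)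
  next
    assume "(u, v) \<in> (parcs G)\<^sup>*"
    then show "(u, v) \<in> rtrancl_on (pverts G) (parcs G)"
      by induction
        (use that simple_graph_arc_verts[OF assms] in \<open>auto intro: rtrancl_on_into_rtrancl_on\<close>)
  qed
  then show ?thesis
    using assms by (simp add: connected_conv arcs simple_graph_def)
qed

lemma sierpinski_product_arc_cases:
  assumes "(p, q) \<in> parcs (sierpinski_product G f H)"
  obtains (copy) g h h' where "p = (g, h)" "q = (g, h')" "g \<in> pverts G" "(h, h') \<in> parcs H"
    | (connecting) g g' where "p = (g, f g')" "q = (g', f g)" "(g, g') \<in> parcs G"
  using assms by (auto simp: sierpinski_product_def)

text \<open>A copy arc projects to a single vertex, a connecting arc to an arc of
  \<open>G\<close>.\<close>

lemma sierpinski_product_rtrancl_fst: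
  assumes "(p, q) \<in> (parcs (sierpinski_product G f H))\<^sup>*"
  shows "(fst p, fst q) \<in> (parcs G)\<^sup>*"
  using assms
proof induction
  case (step q r)
  from step.hyps(2) step.IH show ?case
    by (cases rule: sierpinski_product_arc_cases) (auto intro: rtrancl_into_rtrancl)
qed simp

text \<open>Goodness is the induction invariant, trivial at \<open>(g, f g)\<close>. Across a
  connecting arc from \<open>(x, f y)\<close> to \<open>(y, f x)\<close>, the walk from
  \<open>f x\<close> to \<open>f y\<close> in \<open>H\<close> has to be reversed, which uses the
  symmetry of \<open>H\<close>.\<close>

lemma sierpinski_product_rtrancl_snd:
  assumes "simple_graph H" and "((g, f g), q) \<in> (parcs (sierpinski_product G f H))\<^sup>*"
  shows "(f (fst q), snd q) \<in> (parcs H)\<^sup>*"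
  using assms(2)
proof induction
  case (step q r)
  from step.hyps(2) step.IH show ?case
    by (cases rule: sierpinski_product_arc_cases)
      (auto intro: rtrancl_into_rtrancl simple_graph_rtrancl_sym[OF assms(1)])
qed simp

lemma sierpinski_product_rtrancl_copy:
  assumes "(h, h') \<in> (parcs H)\<^sup>*" and "g \<in> pverts G"
  shows "((g, h), (g, h')) \<in> (parcs (sierpinski_product G f H))\<^sup>*"
  using assms(1)
proof induction
  case (step x y)
  then have "((g, x), (g, y)) \<in> parcs (sierpinski_product G f H)"
    using assms(2) by (auto simp: sierpinski_product_def)
  with step.IH show ?case by (rule rtrancl_into_rtrancl)
qed simp

lemma sierpinski_product_rtrancl:
  assumes G: "simple_graph G" and f: "f \<in> pverts G \<rightarrow> pverts H"
    and H: "\<And>x y. x \<in> pverts H \<Longrightarrow> y \<in> pverts H \<Longrightarrow> (x, y) \<in> (parcs H)\<^sup>*"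
    and gg': "(g, g') \<in> (parcs G)\<^sup>*" and g: "g \<in> pverts G"
    and h: "h \<in> pverts H" and h': "h' \<in> pverts H"
  shows "((g, h), (g', h')) \<in> (parcs (sierpinski_product G f H))\<^sup>*" (is "_ \<in> ?P\<^sup>*")
  using gg' h'
\<comment> \<open>The end \<open>h'\<close> must vary: to cross from \<open>x\<close> to
  \<open>y\<close>, the walk has to reach copy \<open>x\<close> at \<open>f y\<close>.\<close>
proof (induction arbitrary: h')
  case base
  then show ?case using sierpinski_product_rtrancl_copy[OF H[OF h] g] by blast
next
  case (step x y)
  have xy: "x \<in> pverts G" "y \<in> pverts G"
    using simple_graph_arc_verts[OF G step.hyps(2)] by auto
  then have fxy: "f x \<in> pverts H" "f y \<in> pverts H" using f by auto
  have "((g, h), (x, f y)) \<in> ?P\<^sup>*" using step.IH fxy by blast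
  also have "((x, f y), (y, f x)) \<in> ?P"
    using step.hyps(2) by (auto simp: sierpinski_product_def)
  also have "((y, f x), (y, h')) \<in> ?P\<^sup>*"
    using sierpinski_product_rtrancl_copy[OF H[OF fxy(1) step.prems] xy(2)] .
  finally show ?case .
qed

theorem proposition2p10:
  fixes G :: "'a pair_pre_digraph" and H :: "'b pair_pre_digraph" and f :: "'a \<Rightarrow> 'b"
  assumes "simple_graph G" and "simple_graph H"
    and "f \<in> pverts G \<rightarrow> pverts H"
  shows "connected (with_proj (sierpinski_product G f H)) \<longleftrightarrow>
    connected (with_proj G) \<and> connected (with_proj H)"
proof -
  let ?P = "sierpinski_product G f H"
  have P: "connected (with_proj ?P) \<longleftrightarrow> (\<forall>g \<in> pverts G. \<forall>h \<in> pverts H.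
      \<forall>g' \<in> pverts G. \<forall>h' \<in> pverts H. ((g, h), (g', h')) \<in> (parcs ?P)\<^sup>*)"
    using simple_graph_connected_iff[OF simple_graph_sierpinski_product[OF assms]]
    by (auto simp: sierpinski_product_def)
  obtain g0 h0 where g0: "g0 \<in> pverts G" and h0: "h0 \<in> pverts H"
    using assms by (auto simp: simple_graph_def)
  show ?thesis
  proof
    assume conn: "connected (with_proj ?P)"
    have "(g, g') \<in> (parcs G)\<^sup>*" if "g \<in> pverts G" "g' \<in> pverts G" for g g'
    proof -
      have "((g, h0), (g', h0)) \<in> (parcs ?P)\<^sup>*" using conn that h0 by (simp add: P)
      from sierpinski_product_rtrancl_fst[OF this] show ?thesis by simp
    qed
    moreover have fg0: "(f g0, h) \<in> (parcs H)\<^sup>*" if "h \<in> pverts H" for h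
    proof -
      have "f g0 \<in> pverts H" using assms(3) g0 by auto
      \<comment> \<open>Source and target lie in the same copy, but the walk may leave it; starting
        at \<open>f g0\<close> makes the invariant available.\<close>
      then have "((g0, f g0), (g0, h)) \<in> (parcs ?P)\<^sup>*" using conn that g0 by (simp add: P)
      from sierpinski_product_rtrancl_snd[OF assms(2) this] show ?thesis by simp
    qed
    \<comment> \<open>Any two vertices of \<open>H\<close> are joined through
      \<open>f g0\<close>.\<close>
    have "(h, h') \<in> (parcs H)\<^sup>*" if "h \<in> pverts H" "h' \<in> pverts H" for h h'
      using simple_graph_rtrancl_sym[OF assms(2) fg0[OF that(1)]] fg0[OF that(2)]
      by (rule rtrancl_trans)
    ultimately show "connected (with_proj G) \<and> connected (with_proj H)"
      using assms by (simp add: simple_graph_connected_iff)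
  next
    assume "connected (with_proj G) \<and> connected (with_proj H)"
    then show "connected (with_proj ?P)"
      unfolding P using assms
      by (auto simp: simple_graph_connected_iff intro!: sierpinski_product_rtrancl)
  qed
qed

end
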